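(* For every integer $n\geq 2$, the monoid $\mathcal{M}_n$ is singly aligned.
   Context: For a positive integer $n$, let $X_n=\{a,b,c,d,A_1,\dots,A_n,B_1,\dots,B_n,C_1,\dots,C_n,D_1,\dots,D_n\}$ be an alphabet of $4n+4$ distinct letters, and let $\mathcal{M}_n$ be the monoid with monoid presentation $\langle X_n \mid \rho_n\rangle$, where $\rho_n$ consists of the following relations (a pair $(w_1,w_2)$ means the relation $w_1=w_2$): $(da,\,A_1C_1)$; $(A_iD_i,\,A_{i+1}C_{i+1})$ for $1\le i\le n-1$; $(A_nD_n,\,db)$; $(cb,\,B_nD_n)$; $(B_iC_i,\,B_{i-1}D_{i-1})$ for $2\le i\le n$. That is, $\mathcal{M}_n$ is the quotient of the free monoid $X_n^*$ by the congruence generated by $\rho_n$. A left cancellative monoid $M$ (i.e. $xy=xz$ implies $y=z$) is called singly aligned if for all $p,q\in M$, either $pM\cap qM=\varnothing$ or there exists $r\in M$ with $pM\cap qM=rM$, where $pM=\{pm : m\in M\}$. *)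

theory Defs
  imports "HOL-Algebra.Coset"
begin

inductive_set gen_congruence :: "'x set \<Rightarrow> ('x list \<times> 'x list) set \<Rightarrow> ('x list \<times> 'x list) set"
  for X :: "'x set" and R :: "('x list \<times> 'x list) set" where
  base: "(u, v) \<in> R \<Longrightarrow> (u, v) \<in> gen_congruence X R"
| refl: "w \<in> lists X \<Longrightarrow> (w, w) \<in> gen_congruence X R"
| sym: "(u, v) \<in> gen_congruence X R \<Longrightarrow> (v, u) \<in> gen_congruence X R"
| trans: "(u, v) \<in> gen_congruence X R \<Longrightarrow> (v, w) \<in> gen_congruence X R
    \<Longrightarrow> (u, w) \<in> gen_congruence X R"
| append: "(u, v) \<in> gen_congruence X R \<Longrightarrow> (u', v') \<in> gen_congruence X R
    \<Longrightarrow> (u @ u', v @ v') \<in> gen_congruence X R"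

text \<open>The monoid \<open>\<langle>X | R\<rangle>\<close>. The union in the multiplication is a single class,
  namely the class of the concatenation of any two representatives
  (\<open>presented_monoid_mult\<close> below).\<close>

definition presented_monoid ::
    "'x set \<Rightarrow> ('x list \<times> 'x list) set \<Rightarrow> 'x list set monoid" where
  "presented_monoid X R =
    \<lparr> carrier = lists X // gen_congruence X R,
      mult = (\<lambda>P Q. \<Union>u\<in>P. \<Union>v\<in>Q. gen_congruence X R `` {u @ v}),
      one = gen_congruence X R `` {[]} \<rparr>"

lemma gen_congruence_subset:
  assumes "R \<subseteq> lists X \<times> lists X"
  shows "gen_congruence X R \<subseteq> lists X \<times> lists X"
proof -
  have "u \<in> lists X \<and> v \<in> lists X" if "(u, v) \<in> gen_congruence X R" for u v
    using that assms by induction auto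
  then show ?thesis by auto
qed

lemma equiv_gen_congruence:
  assumes "R \<subseteq> lists X \<times> lists X"
  shows "equiv (lists X) (gen_congruence X R)"
proof (rule equivI)
  show "gen_congruence X R \<subseteq> lists X \<times> lists X"
    by (rule gen_congruence_subset[OF assms])
  show "refl_on (lists X) (gen_congruence X R)"
    by (rule refl_onI) (rule gen_congruence.refl)
  show "sym (gen_congruence X R)"
    by (rule symI) (rule gen_congruence.sym)
  show "trans (gen_congruence X R)"
    by (rule transI) (rule gen_congruence.trans)
qed

lemma gen_congruence_least:
  assumes "equiv (lists X) E" and "R \<subseteq> E"
    and "\<And>u v u' v'. (u, v) \<in> E \<Longrightarrow> (u', v') \<in> E \<Longrightarrow> (u @ u', v @ v') \<in> E"
  shows "gen_congruence X R \<subseteq> E"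
proof -
  have rE: "refl_on (lists X) E" and sE: "sym E" and tE: "trans E"
    using assms(1) by (auto elim: equivE)
  have "(u, v) \<in> E" if "(u, v) \<in> gen_congruence X R" for u v
    using that
  proof induction
    case (base u v)
    then show ?case using assms(2) by blast
  next
    case (refl w)
    then show ?case by (rule refl_onD[OF rE])
  next
    case (sym u v)
    show ?case by (rule symD[OF sE sym.IH])
  next
    case (trans u v w)
    show ?case by (rule transD[OF tE trans.IH])
  next
    case (append u v u' v')
    show ?case by (rule assms(3)[OF append.IH])
  qed
  then show ?thesis by auto
qed

lemma presented_monoid_mult:
  assumes "R \<subseteq> lists X \<times> lists X" and "u \<in> lists X" and "v \<in> lists X"
  shows "(gen_congruence X R `` {u}) \<otimes>\<^bsub>presented_monoid X R\<^esub> (gen_congruence X R `` {v})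
    = gen_congruence X R `` {u @ v}"
proof -
  let ?E = "gen_congruence X R"
  have "?E `` {u' @ v'} = ?E `` {u @ v}" if "(u, u') \<in> ?E" "(v, v') \<in> ?E" for u' v'
    by (rule equiv_class_eq[OF equiv_gen_congruence[OF assms(1)], symmetric])
      (rule gen_congruence.append[OF that])
  moreover have "(u, u) \<in> ?E" "(v, v) \<in> ?E"
    using assms by (auto intro: gen_congruence.refl)
  ultimately have "(\<Union>u'\<in>?E `` {u}. \<Union>v'\<in>?E `` {v}. ?E `` {u' @ v'}) = ?E `` {u @ v}"
    by blast
  then show ?thesis
    by (simp only: presented_monoid_def monoid.simps partial_object.simps)
qed

lemma monoid_presented_monoid:
  assumes R: "R \<subseteq> lists X \<times> lists X"
  shows "monoid (presented_monoid X R)"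
proof -
  let ?M = "presented_monoid X R" and ?c = "\<lambda>w. gen_congruence X R `` {w}"
  have C: "carrier ?M = ?c ` lists X" and one: "\<one>\<^bsub>?M\<^esub> = ?c []"
    by (auto simp: presented_monoid_def quotient_def)
  note m = presented_monoid_mult[OF R]
  show ?thesis
  proof (rule monoidI)
    show "x \<otimes>\<^bsub>?M\<^esub> y \<in> carrier ?M" if xy: "x \<in> carrier ?M" "y \<in> carrier ?M" for x y
    proof -
      obtain u v where "u \<in> lists X" "x = ?c u" "v \<in> lists X" "y = ?c v"
        using xy unfolding C by blast
      then show ?thesis
        unfolding C by (intro image_eqI[of _ _ "u @ v"]) (simp_all only: m append_in_lists_conv)
    qed
    show "\<one>\<^bsub>?M\<^esub> \<in> carrier ?M"
      unfolding C one by blast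
    show "x \<otimes>\<^bsub>?M\<^esub> y \<otimes>\<^bsub>?M\<^esub> z = x \<otimes>\<^bsub>?M\<^esub> (y \<otimes>\<^bsub>?M\<^esub> z)"
      if xyz: "x \<in> carrier ?M" "y \<in> carrier ?M" "z \<in> carrier ?M" for x y z
    proof -
      obtain u v w where "u \<in> lists X" "x = ?c u" "v \<in> lists X" "y = ?c v" "w \<in> lists X" "z = ?c w"
        using xyz unfolding C by blast
      then show ?thesis
        by (simp only: m append_in_lists_conv append_assoc simp_thms)
    qed
    show "\<one>\<^bsub>?M\<^esub> \<otimes>\<^bsub>?M\<^esub> x = x" if x: "x \<in> carrier ?M" for x
    proof -
      obtain u where "u \<in> lists X" "x = ?c u"
        using x unfolding C by blast
      then show ?thesis
        by (simp only: one m lists.Nil append.simps)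
    qed
    show "x \<otimes>\<^bsub>?M\<^esub> \<one>\<^bsub>?M\<^esub> = x" if x: "x \<in> carrier ?M" for x
    proof -
      obtain u where "u \<in> lists X" "x = ?c u"
        using x unfolding C by blast
      then show ?thesis
        by (simp only: one m lists.Nil append_Nil2)
    qed
  qed
qed

locale left_cancellative_monoid = monoid M for M :: "('a, 'b) monoid_scheme" (structure) +
  assumes left_cancel: "\<lbrakk> x \<in> carrier M; y \<in> carrier M; z \<in> carrier M; x \<otimes> y = x \<otimes> z \<rbrakk> \<Longrightarrow> y = z"

locale singly_aligned_monoid = left_cancellative_monoid M
  for M :: "('a, 'b) monoid_scheme" (structure) +
  assumes singly_aligned: "\<lbrakk> p \<in> carrier M; q \<in> carrier M \<rbrakk> \<Longrightarrow>
    (p <# carrier M) \<inter> (q <# carrier M) = {} \<or>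
    (\<exists>r\<in>carrier M. (p <# carrier M) \<inter> (q <# carrier M) = r <# carrier M)"

text \<open>\<open>La\<close> is the letter \<open>a\<close> and \<open>LA i\<close> is \<open>A\<^sub>i\<close>, etc.; the bounds on \<open>i\<close> are in \<open>X\<close>.\<close>

datatype letter = La | Lb | Lc | Ld | LA nat | LB nat | LC nat | LD nat

definition X :: "nat \<Rightarrow> letter set" where
  "X n = {La, Lb, Lc, Ld} \<union> LA ` {1..n} \<union> LB ` {1..n} \<union> LC ` {1..n} \<union> LD ` {1..n}"

definition \<rho> :: "nat \<Rightarrow> (letter list \<times> letter list) set" where
  "\<rho> n =
    {([Ld, La], [LA 1, LC 1])}
    \<union> {([LA i, LD i], [LA (i + 1), LC (i + 1)]) | i. 1 \<le> i \<and> i \<le> n - 1}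
    \<union> {([LA n, LD n], [Ld, Lb])}
    \<union> {([Lc, Lb], [LB n, LD n])}
    \<union> {([LB i, LC i], [LB (i - 1), LD (i - 1)]) | i. 2 \<le> i \<and> i \<le> n}"

definition \<M> :: "nat \<Rightarrow> letter list set monoid" where
  "\<M> n = presented_monoid (X n) (\<rho> n)"

lemma \<rho>_subset:
  assumes "1 \<le> n"
  shows "\<rho> n \<subseteq> lists (X n) \<times> lists (X n)"
proof -
  have "LA i \<in> X n \<and> LB i \<in> X n \<and> LC i \<in> X n \<and> LD i \<in> X n" if "1 \<le> i" "i \<le> n" for i
    using that by (simp add: X_def)
  moreover have "La \<in> X n" "Lb \<in> X n" "Lc \<in> X n" "Ld \<in> X n"
    by (simp_all add: X_def)
  ultimately show ?thesis
    using assms by (auto simp: \<rho>_def)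
qed

end

theory Submission imports Defs begin

text \<open>
  Every relation of \<open>\<M> n\<close> equates two words of length two, \<open>x s = y t\<close>, whose first letters
  \<open>x, y\<close> are among \<open>d, A\<^sub>i, c, B\<^sub>i\<close> and whose second letters \<open>s, t\<close> are among
  \<open>a, b, C\<^sub>i, D\<^sub>i\<close>. No letter can therefore stand both at the start and at the end of a side of
  a relation, so that two occurrences of such sides in one word never overlap, and a rewriting step
  neither creates nor destroys an occurrence. Two words are then equal in the monoid exactly when
  one turns into the other by replacing sides of relations at disjoint places, which can be read
  off from left to right in a single pass (\<open>gen_congruence_eq_word_eq\<close>).

  This turns both claims into inductions on words. Two words with the same first letter can
  only be equal if their tails are, which is left cancellation. Two words \<open>x p\<close> and \<open>y q\<close>
  with \<open>x \<noteq> y\<close> have a common right multiple only through a relation \<open>x s = y t\<close>; for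
  \<open>n \<ge> 2\<close> the letters \<open>x\<close> and \<open>y\<close> determine \<open>s\<close> and \<open>t\<close>, so every common multiple passes through
  this relation, and what remains is the same question for shorter words
  (\<open>least_common_multiple\<close>).

  For \<open>n = 1\<close> the letters \<open>d\<close> and \<open>A\<^sub>1\<close> begin the two sides of two different relations,
  \<open>d a = A\<^sub>1 C\<^sub>1\<close> and \<open>A\<^sub>1 D\<^sub>1 = d b\<close>, and there is no least common multiple of \<open>d\<close>
  and \<open>A\<^sub>1\<close>.
\<close>

section \<open>Presentations without overlaps\<close>

text \<open>The set \<open>I\<close> contains the letters that may begin a side of a relation. The hypothesis
  \<open>partner\<close> says that a word can be exchanged for at most one other by a relation, and
  \<open>complement\<close> that two letters begin the two sides of at most one relation; applied to a
  relation and its converse, \<open>complement\<close> also rules out relations \<open>x s = x t\<close> with \<open>s \<noteq> t\<close>.\<close>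

locale separated_presentation =
  fixes X :: "'x set" and I :: "'x set" and R :: "('x list \<times> 'x list) set"
  assumes rel_form: "(u, v) \<in> R \<Longrightarrow>
      \<exists>x s y t. u = [x, s] \<and> v = [y, t] \<and> {x, y} \<subseteq> X \<inter> I \<and> {s, t} \<subseteq> X - I"
    and partner: "single_valued (R \<union> R\<inverse>)"
    and complement: "([x, s], [y, t]) \<in> R \<union> R\<inverse> \<Longrightarrow> ([x, s'], [y, t']) \<in> R \<union> R\<inverse> \<Longrightarrow> s = s'"
begin

lemma R_subset: "R \<subseteq> lists X \<times> lists X"
  using rel_form by fastforce

lemma rel_letters:
  assumes "([x, s], [y, t]) \<in> R \<union> R\<inverse>"
  shows "x \<in> X" "y \<in> X" "s \<in> X" "t \<in> X" "x \<in> I" "y \<in> I" "s \<notin> I" "t \<notin> I"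
  using assms by (auto dest: rel_form)

lemma rel_sym: "(u, v) \<in> R \<union> R\<inverse> \<Longrightarrow> (v, u) \<in> R \<union> R\<inverse>"
  by auto

lemma rel_same_first: "([x, s], [x, t]) \<in> R \<union> R\<inverse> \<Longrightarrow> s = t"
  using complement rel_sym by blast

lemma complement_both:
  assumes "([x, s], [y, t]) \<in> R \<union> R\<inverse>" and "([x, s'], [y, t']) \<in> R \<union> R\<inverse>"
  shows "s' = s \<and> t' = t"
  using complement[OF assms] complement[OF rel_sym[OF assms(1)] rel_sym[OF assms(2)]] by simp

section \<open>The word problem\<close>

text \<open>Equality of words in the presented monoid, read from left to right: at each place the two
  words either have the same letter or the two sides of a relation. Symmetry and transitivity are
  not built in, so that case analysis on an equation shows how the two words begin.\<close>

inductive word_eq :: "'x list \<Rightarrow> 'x list \<Rightarrow> bool" where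
  Nil: "word_eq [] []"
| letter: "x \<in> X \<Longrightarrow> word_eq u v \<Longrightarrow> word_eq (x # u) (x # v)"
| relation: "([x, s], [y, t]) \<in> R \<union> R\<inverse> \<Longrightarrow> word_eq u v \<Longrightarrow> word_eq (x # s # u) (y # t # v)"

lemma word_eq_in_lists: "word_eq u v \<Longrightarrow> u \<in> lists X \<and> v \<in> lists X"
proof (induction rule: word_eq.induct)
  case (relation x s y t u v)
  then show ?case using rel_letters(1-4)[OF relation.hyps(1)] by simp
qed auto

lemma word_eq_refl: "u \<in> lists X \<Longrightarrow> word_eq u u"
  by (induction u rule: lists.induct) (auto intro: word_eq.intros)

lemma word_eq_sym: "word_eq u v \<Longrightarrow> word_eq v u"
  by (induction rule: word_eq.induct) (blast intro: word_eq.intros)+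

lemma word_eq_append: "word_eq u v \<Longrightarrow> word_eq u' v' \<Longrightarrow> word_eq (u @ u') (v @ v')"
  by (induction rule: word_eq.induct) (auto intro: word_eq.intros)

text \<open>A letter outside \<open>I\<close> does not begin a side of a relation, so an equation that starts
  with it must match it with itself.\<close>

lemma word_eq_Cons_not_initial:
  assumes "word_eq (s # u) v" and "s \<notin> I"
  obtains v' where "v = s # v'" and "word_eq u v'"
  using assms(1)
proof cases
  case letter
  then show thesis using that by blast
next
  case relation
  then show thesis using rel_letters(5) assms(2) by blast
qed

text \<open>If the second equation uses a relation at the front, then the second letter of the middle
  word is outside \<open>I\<close>; hence the first equation either uses a relation at the same two letters or
  leaves both letters unchanged. This is where the absence of overlaps enters.\<close>

lemma word_eq_trans: "word_eq u v \<Longrightarrow> word_eq v w \<Longrightarrow> word_eq u w"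
proof (induction arbitrary: w rule: word_eq.induct)
  case Nil
  then show ?case by simp
next
  case (letter x u v)
  from letter.prems show ?case
  proof cases
    case (letter v')
    with \<open>x \<in> X\<close> letter.IH show ?thesis by (auto intro: word_eq.letter)
  next
    case (relation s y t v' w')
    have "word_eq (s # v') u"
      using letter.hyps relation(1) by (auto intro: word_eq_sym)
    then obtain u' where u: "u = s # u'"
      using rel_letters(7)[OF relation(3)] by (rule word_eq_Cons_not_initial)
    have "word_eq v (s # w')"
      using relation rel_letters(3)[OF relation(3)] by (auto intro: word_eq.letter)
    then have "word_eq (s # u') (s # w')"
      using letter.IH u by simp
    then have "word_eq u' w'"
      using rel_letters(7)[OF relation(3)] by (auto elim: word_eq_Cons_not_initial)
    with relation u show ?thesis by (auto intro: word_eq.relation)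
  qed
next
  case (relation x s y t u v)
  note rel = \<open>([x, s], [y, t]) \<in> R \<union> R\<inverse>\<close>
  from relation.prems show ?case
  proof cases
    case (letter w')
    then obtain w'' where "w' = t # w''" "word_eq v w''"
      using rel_letters(8)[OF rel] by (auto elim: word_eq_Cons_not_initial)
    with letter rel relation.IH show ?thesis by (auto intro: word_eq.relation)
  next
    case (relation z r w')
    \<comment> \<open>Both equations use a relation here, and the middle word \<open>[y, t]\<close> has a single partner:
      the second relation undoes the first.\<close>
    have "[z, r] = [x, s]"
      using partner rel_sym[OF rel] relation unfolding single_valued_def by blast
    moreover have "word_eq u w'"
      using relation \<open>\<And>w. word_eq v w \<Longrightarrow> word_eq u w\<close> by blast
    ultimately show ?thesis
      using relation rel_letters[OF rel] by (auto intro: word_eq.letter)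
  qed
qed

lemma gen_congruence_eq_word_eq: "(u, v) \<in> gen_congruence X R \<longleftrightarrow> word_eq u v"
proof
  have "gen_congruence X R \<subseteq> {(u, v). word_eq u v}"
  proof (rule gen_congruence_least)
    show "equiv (lists X) {(u, v). word_eq u v}"
    proof (rule equivI)
      show "{(u, v). word_eq u v} \<subseteq> lists X \<times> lists X"
        using word_eq_in_lists by blast
      show "refl_on (lists X) {(u, v). word_eq u v}"
        by (rule refl_onI) (simp add: word_eq_refl)
      show "sym {(u, v). word_eq u v}"
        by (rule symI) (simp add: word_eq_sym)
      show "trans {(u, v). word_eq u v}"
        by (rule transI) (auto intro: word_eq_trans)
    qed
    show "R \<subseteq> {(u, v). word_eq u v}"
    proof clarify
      fix u v assume rel: "(u, v) \<in> R"
      then obtain x s y t where "u = [x, s]" "v = [y, t]"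
        using rel_form by blast
      then show "word_eq u v"
        using rel word_eq.relation[OF _ word_eq.Nil] by simp
    qed
  qed (auto intro: word_eq_append)
  then show "(u, v) \<in> gen_congruence X R \<Longrightarrow> word_eq u v"
    by blast
next
  show "word_eq u v \<Longrightarrow> (u, v) \<in> gen_congruence X R"
  proof (induction rule: word_eq.induct)
    case Nil
    show ?case by (simp add: gen_congruence.refl)
  next
    case (letter x u v)
    then have "([x], [x]) \<in> gen_congruence X R"
      by (simp add: gen_congruence.refl)
    from gen_congruence.append[OF this letter.IH] show ?case by simp
  next
    case (relation x s y t u v)
    then have "([x, s], [y, t]) \<in> gen_congruence X R"
      by (auto intro: gen_congruence.base gen_congruence.sym)
    from gen_congruence.append[OF this relation.IH] show ?case by simp
  qed
qed

section \<open>Cancellation and least common right multiples of words\<close>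

lemma word_eq_Cons_cancel:
  assumes "word_eq (x # u) (x # v)"
  shows "word_eq u v"
  using assms
proof cases
  case letter
  then show ?thesis by blast
next
  case (relation s t u' v')
  then show ?thesis
    using rel_same_first[OF relation(3)] rel_letters(3)[OF relation(3)]
    by (simp add: word_eq.letter)
qed

lemma word_eq_append_cancel: "word_eq (p @ u) (p @ v) \<Longrightarrow> word_eq u v"
  by (induction p) (auto dest: word_eq_Cons_cancel)

lemma word_eq_Cons_neq:
  assumes "word_eq (x # u) (y # v)" and "x \<noteq> y"
  obtains s t u' v' where "u = s # u'" "v = t # v'" "([x, s], [y, t]) \<in> R \<union> R\<inverse>" "word_eq u' v'"
  using assms(1)
proof cases
  case letter
  then show thesis using assms(2) by simp
next
  case (relation s t u' v')
  then show thesis by (rule that)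
qed

text \<open>The words \<open>u0\<close> and \<open>v0\<close> complete \<open>p\<close> and \<open>q\<close> to a least common right multiple. If \<open>p\<close> and
  \<open>q\<close> begin with different letters, the given common multiple starts with a relation
  \<open>x s = y t\<close>; by \<open>complement\<close> all other common multiples start with the same one. A letter
  \<open>s\<close> or \<open>t\<close> that is not supplied by \<open>p\<close> or \<open>q\<close> becomes the first letter of \<open>u0\<close> or \<open>v0\<close>.\<close>

lemma least_common_multiple:
  assumes "word_eq (p @ u) (q @ v)"
  shows "\<exists>u0 v0. word_eq (p @ u0) (q @ v0) \<and>
    (\<forall>u v. word_eq (p @ u) (q @ v) \<longrightarrow> (\<exists>m. word_eq u (u0 @ m) \<and> word_eq v (v0 @ m)))"
  using assms
proof (induction "length p" arbitrary: p q u v rule: less_induct)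
  case less
  have lists: "p \<in> lists X" "q \<in> lists X"
    using word_eq_in_lists[OF less.prems] by auto
  show ?case
  proof (cases "p = [] \<or> q = []")
    case True
    then show ?thesis
    proof
      assume p: "p = []"
      show ?thesis
      proof (rule exI[of _ q], rule exI[of _ "[]"], intro conjI allI impI)
        show "word_eq (p @ q) (q @ [])" using lists p by (simp add: word_eq_refl)
        show "\<exists>m. word_eq u (q @ m) \<and> word_eq v ([] @ m)" if "word_eq (p @ u) (q @ v)" for u v
          using that p word_eq_in_lists[OF that] by (intro exI[of _ v]) (simp add: word_eq_refl)
      qed
    next
      assume q: "q = []"
      show ?thesis
      proof (rule exI[of _ "[]"], rule exI[of _ p], intro conjI allI impI)
        show "word_eq (p @ []) (q @ p)" using lists q by (simp add: word_eq_refl)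
        show "\<exists>m. word_eq u ([] @ m) \<and> word_eq v (p @ m)" if "word_eq (p @ u) (q @ v)" for u v
          using that q word_eq_in_lists[OF that]
          by (intro exI[of _ u]) (simp add: word_eq_refl word_eq_sym)
      qed
    qed
  next
    case False
    then obtain x p' y q' where pq: "p = x # p'" "q = y # q'"
      by (meson neq_Nil_conv)
    show ?thesis
    proof (cases "x = y")
      case True
      have x: "x \<in> X" using lists pq by simp
      have iff: "word_eq (p @ u) (q @ v) \<longleftrightarrow> word_eq (p' @ u) (q' @ v)" for u v
        using word_eq.letter[OF x] word_eq_Cons_cancel True pq by (metis append_Cons)
      have "length p' < length p" using pq by simp
      from less.hyps[OF this less.prems[unfolded iff]] show ?thesis
        unfolding iff .
    next
      case False
      obtain s t u' v' where st: "p' @ u = s # u'" "q' @ v = t # v'"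
          and rel: "([x, s], [y, t]) \<in> R \<union> R\<inverse>" and eq: "word_eq u' v'"
        by (rule word_eq_Cons_neq[OF less.prems[unfolded pq append_Cons] False])
      have iff: "word_eq (p @ u) (q @ v) \<longleftrightarrow>
          (\<exists>u' v'. p' @ u = s # u' \<and> q' @ v = t # v' \<and> word_eq u' v')" for u v
      proof
        assume "word_eq (p @ u) (q @ v)"
        then have "word_eq (x # p' @ u) (y # q' @ v)" using pq by simp
        then obtain s' t' u' v' where uv: "p' @ u = s' # u'" "q' @ v = t' # v'"
            and rel': "([x, s'], [y, t']) \<in> R \<union> R\<inverse>" and "word_eq u' v'"
          using False by (rule word_eq_Cons_neq)
        moreover have "s' = s \<and> t' = t" by (rule complement_both[OF rel rel'])
        ultimately show "\<exists>u' v'. p' @ u = s # u' \<and> q' @ v = t # v' \<and> word_eq u' v'"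
          by simp
      next
        assume "\<exists>u' v'. p' @ u = s # u' \<and> q' @ v = t # v' \<and> word_eq u' v'"
        then show "word_eq (p @ u) (q @ v)"
          using pq word_eq.relation[OF rel] by auto
      qed
      have st_X: "s \<in> X" "t \<in> X" using rel_letters[OF rel] by auto
      consider
          (both) "p' = []" "q' = []"
        | (left) q'' where "p' = []" "q' = t # q''"
        | (right) p'' where "p' = s # p''" "q' = []"
        | (none) p'' q'' where "p' = s # p''" "q' = t # q''"
        using st by (cases p'; cases q') auto
      then show ?thesis
      proof cases
        case both
        show ?thesis
        proof (rule exI[of _ "[s]"], rule exI[of _ "[t]"], intro conjI allI impI)
          show "word_eq (p @ [s]) (q @ [t])"
            unfolding iff using both by (simp add: word_eq.Nil)
          show "\<exists>m. word_eq u ([s] @ m) \<and> word_eq v ([t] @ m)" if "word_eq (p @ u) (q @ v)" for u v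
          proof -
            obtain u' v' where uv: "u = s # u'" "v = t # v'" and eq: "word_eq u' v'"
              using \<open>word_eq (p @ u) (q @ v)\<close> unfolding iff using both by auto
            have "v' \<in> lists X" using word_eq_in_lists[OF eq] by simp
            then show ?thesis
              using uv eq st_X by (intro exI[of _ v']) (simp add: word_eq.letter word_eq_refl)
          qed
        qed
      next
        case left
        have q'': "q'' \<in> lists X" using lists pq left by simp
        show ?thesis
        proof (rule exI[of _ "s # q''"], rule exI[of _ "[]"], intro conjI allI impI)
          show "word_eq (p @ s # q'') (q @ [])"
            unfolding iff using left word_eq_refl[OF q''] by simp
          show "\<exists>m. word_eq u ((s # q'') @ m) \<and> word_eq v ([] @ m)"
            if "word_eq (p @ u) (q @ v)" for u v
          proof -
            obtain u' where u: "u = s # u'" and eq: "word_eq u' (q'' @ v)"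
              using \<open>word_eq (p @ u) (q @ v)\<close> unfolding iff using left by auto
            have "v \<in> lists X" using word_eq_in_lists[OF eq] by simp
            then show ?thesis
              using u eq st_X by (intro exI[of _ v]) (simp add: word_eq.letter word_eq_refl)
          qed
        qed
      next
        case right
        have p'': "p'' \<in> lists X" using lists pq right by simp
        show ?thesis
        proof (rule exI[of _ "[]"], rule exI[of _ "t # p''"], intro conjI allI impI)
          show "word_eq (p @ []) (q @ t # p'')"
            unfolding iff using right word_eq_refl[OF p''] by simp
          show "\<exists>m. word_eq u ([] @ m) \<and> word_eq v ((t # p'') @ m)"
            if "word_eq (p @ u) (q @ v)" for u v
          proof -
            obtain v' where v: "v = t # v'" and eq: "word_eq v' (p'' @ u)"
              using \<open>word_eq (p @ u) (q @ v)\<close> unfolding iff using right by (auto intro: word_eq_sym)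
            have "u \<in> lists X" using word_eq_in_lists[OF eq] by simp
            then show ?thesis
              using v eq st_X by (intro exI[of _ u]) (simp add: word_eq.letter word_eq_refl)
          qed
        qed
      next
        case none
        then have iff': "word_eq (p @ u) (q @ v) \<longleftrightarrow> word_eq (p'' @ u) (q'' @ v)" for u v
          unfolding iff by simp
        have "length p'' < length p" using pq none by simp
        from less.hyps[OF this less.prems[unfolded iff']] show ?thesis
          unfolding iff' .
      qed
    qed
  qed
qed

section \<open>The presented monoid\<close>

abbreviation cls :: "'x list \<Rightarrow> 'x list set" where
  "cls w \<equiv> gen_congruence X R `` {w}"

lemma cls_eq_iff:
  assumes "u \<in> lists X" and "v \<in> lists X"
  shows "cls u = cls v \<longleftrightarrow> word_eq u v"
  using eq_equiv_class_iff[OF equiv_gen_congruence[OF R_subset] assms]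
  unfolding gen_congruence_eq_word_eq .

lemma carrier_presented_monoid: "carrier (presented_monoid X R) = cls ` lists X"
  unfolding presented_monoid_def quotient_def partial_object.simps by blast

lemma cls_coset:
  assumes "p \<in> lists X"
  shows "cls p <#\<^bsub>presented_monoid X R\<^esub> carrier (presented_monoid X R)
    = (\<lambda>u. cls (p @ u)) ` lists X"
proof -
  let ?M = "presented_monoid X R"
  have "cls p <#\<^bsub>?M\<^esub> carrier ?M = (\<lambda>h. cls p \<otimes>\<^bsub>?M\<^esub> h) ` cls ` lists X"
    unfolding l_coset_def carrier_presented_monoid by (rule UNION_singleton_eq_range)
  also have "\<dots> = (\<lambda>u. cls p \<otimes>\<^bsub>?M\<^esub> cls u) ` lists X"
    by (rule image_image)
  also have "\<dots> = (\<lambda>u. cls (p @ u)) ` lists X"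
    by (rule image_cong[OF HOL.refl presented_monoid_mult[OF R_subset assms]])
  finally show ?thesis .
qed

theorem singly_aligned_presented_monoid: "singly_aligned_monoid (presented_monoid X R)"
proof -
  let ?M = "presented_monoid X R"
  interpret monoid ?M by (rule monoid_presented_monoid[OF R_subset])
  show ?thesis
  proof unfold_locales
    fix x y z
    assume "x \<in> carrier ?M" "y \<in> carrier ?M" "z \<in> carrier ?M"
      and eq: "x \<otimes>\<^bsub>?M\<^esub> y = x \<otimes>\<^bsub>?M\<^esub> z"
    then obtain p u v where w: "p \<in> lists X" "u \<in> lists X" "v \<in> lists X"
        and xyz: "x = cls p" "y = cls u" "z = cls v"
      unfolding carrier_presented_monoid by blast
    have "cls (p @ u) = cls (p @ v)"
      using eq w unfolding xyz by (simp only: presented_monoid_mult[OF R_subset])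
    then have "word_eq (p @ u) (p @ v)" using w by (simp only: cls_eq_iff append_in_lists_conv)
    then have "word_eq u v" by (rule word_eq_append_cancel)
    then show "y = z" using w unfolding xyz by (simp only: cls_eq_iff)
  next
    fix P Q
    assume "P \<in> carrier ?M" "Q \<in> carrier ?M"
    then obtain p q where w: "p \<in> lists X" "q \<in> lists X" and PQ: "P = cls p" "Q = cls q"
      unfolding carrier_presented_monoid by blast
    let ?P = "P <#\<^bsub>?M\<^esub> carrier ?M" and ?Q = "Q <#\<^bsub>?M\<^esub> carrier ?M"
    have P: "?P = (\<lambda>u. cls (p @ u)) ` lists X" and Q: "?Q = (\<lambda>u. cls (q @ u)) ` lists X"
      unfolding PQ by (rule cls_coset, fact w)+
    show "?P \<inter> ?Q = {} \<or> (\<exists>r\<in>carrier ?M. ?P \<inter> ?Q = r <#\<^bsub>?M\<^esub> carrier ?M)"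
    proof (cases "\<exists>u v. word_eq (p @ u) (q @ v)")
      case False
      have "?P \<inter> ?Q = {}"
      proof (rule ccontr)
        assume "?P \<inter> ?Q \<noteq> {}"
        then obtain u v where "u \<in> lists X" "v \<in> lists X" "cls (p @ u) = cls (q @ v)"
          unfolding P Q by blast
        with False w show False by (simp only: cls_eq_iff append_in_lists_conv) blast
      qed
      then show ?thesis by simp
    next
      case True
      then obtain u0 v0 where eq0: "word_eq (p @ u0) (q @ v0)"
          and least: "\<And>u v. word_eq (p @ u) (q @ v) \<Longrightarrow>
            \<exists>m. word_eq u (u0 @ m) \<and> word_eq v (v0 @ m)"
        using least_common_multiple by metis
      have w0: "u0 \<in> lists X" "v0 \<in> lists X"
        using word_eq_in_lists[OF eq0] by auto
      have "cls (p @ u0) <#\<^bsub>?M\<^esub> carrier ?M = (\<lambda>m. cls ((p @ u0) @ m)) ` lists X"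
        by (rule cls_coset) (use w w0 in simp)
      moreover have "?P \<inter> ?Q = (\<lambda>m. cls ((p @ u0) @ m)) ` lists X"
      proof
        show "?P \<inter> ?Q \<subseteq> (\<lambda>m. cls ((p @ u0) @ m)) ` lists X"
        proof
          fix z assume "z \<in> ?P \<inter> ?Q"
          then obtain u v where uv: "u \<in> lists X" "v \<in> lists X"
              and z: "z = cls (p @ u)" "cls (p @ u) = cls (q @ v)"
            unfolding P Q by blast
          then have "word_eq (p @ u) (q @ v)"
            using w by (simp only: cls_eq_iff append_in_lists_conv)
          from least[OF this] obtain m where m: "word_eq u (u0 @ m)" by blast
          then have "word_eq (p @ u) ((p @ u0) @ m)"
            using w by (simp add: word_eq_append word_eq_refl)
          moreover have "m \<in> lists X" using word_eq_in_lists[OF m] by simp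
          ultimately show "z \<in> (\<lambda>m. cls ((p @ u0) @ m)) ` lists X"
            unfolding z(1) using w w0 uv by (intro image_eqI[of _ _ m])
              (simp_all only: cls_eq_iff append_in_lists_conv)
        qed
        show "(\<lambda>m. cls ((p @ u0) @ m)) ` lists X \<subseteq> ?P \<inter> ?Q"
        proof
          fix z assume "z \<in> (\<lambda>m. cls ((p @ u0) @ m)) ` lists X"
          then obtain m where m: "m \<in> lists X" and z: "z = cls (p @ (u0 @ m))"
            by auto
          have "word_eq ((p @ u0) @ m) ((q @ v0) @ m)"
            by (rule word_eq_append[OF eq0 word_eq_refl[OF m]])
          then have "z = cls (q @ (v0 @ m))"
            using z w w0 m by (simp only: cls_eq_iff append_in_lists_conv append_assoc)
          then show "z \<in> ?P \<inter> ?Q"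
            unfolding P Q using \<open>z = cls (p @ (u0 @ m))\<close> m w0
            by (intro IntI image_eqI[of _ _ "u0 @ m"] image_eqI[of _ _ "v0 @ m"]) simp_all
        qed
      qed
      moreover have "cls (p @ u0) \<in> carrier ?M"
        unfolding carrier_presented_monoid using w w0 by auto
      ultimately have "\<exists>r\<in>carrier ?M. ?P \<inter> ?Q = r <#\<^bsub>?M\<^esub> carrier ?M"
        by (intro bexI[of _ "cls (p @ u0)"]) simp_all
      then show ?thesis ..
    qed
  qed
qed

end

section \<open>The monoids \<open>\<M> n\<close>\<close>

theorem theorem4p7:
  fixes n :: nat
  assumes "n \<ge> 2"
  shows "singly_aligned_monoid (\<M> n)"
proof -
  define I where "I = {Lc, Ld} \<union> range LA \<union> range LB"
  interpret separated_presentation "X n" I "\<rho> n"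
  proof
    have mem: "La \<in> X n" "Lb \<in> X n" "Lc \<in> X n" "Ld \<in> X n"
      "LA i \<in> X n \<longleftrightarrow> 1 \<le> i \<and> i \<le> n" "LB i \<in> X n \<longleftrightarrow> 1 \<le> i \<and> i \<le> n"
      "LC i \<in> X n \<longleftrightarrow> 1 \<le> i \<and> i \<le> n" "LD i \<in> X n \<longleftrightarrow> 1 \<le> i \<and> i \<le> n" for i
      by (auto simp: X_def)
    show "\<exists>x s y t. u = [x, s] \<and> v = [y, t] \<and> {x, y} \<subseteq> X n \<inter> I \<and> {s, t} \<subseteq> X n - I"
      if "(u, v) \<in> \<rho> n" for u v
      using that assms by (auto simp: \<rho>_def mem I_def)
    show "single_valued (\<rho> n \<union> (\<rho> n)\<inverse>)"
      using assms by (auto simp: \<rho>_def single_valued_def)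
    \<comment> \<open>The letter \<open>d\<close> is related to \<open>A\<^sub>1\<close> and to \<open>A\<^sub>n\<close>, which differ as \<open>n \<ge> 2\<close>.\<close>
    show "s = s'"
      if "([x, s], [y, t]) \<in> \<rho> n \<union> (\<rho> n)\<inverse>" "([x, s'], [y, t']) \<in> \<rho> n \<union> (\<rho> n)\<inverse>" for x s y t s' t'
      using that assms by (auto simp: \<rho>_def)
  qed
  show ?thesis
    unfolding \<M>_def by (rule singly_aligned_presented_monoid)
qed

end
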